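(* The map $V:\mathcal{M}\to\mathcal{C}$, $(V\psi)(f)=\psi(\tilde f)$ for $f\in l^\infty$, where $\tilde f(x) = f([x])$ for $x\ge 1$, is an affine homeomorphism of $\mathcal{M}$ onto $\mathcal{C}$ (both with their weak* topologies).
   Context: $l^\infty$ is the space of real bounded functions on $\mathbb{N}=\{1,2,\dots\}$ and $L^\infty([1,\infty))$ the space of real essentially bounded Lebesgue measurable functions on $[1,\infty)$. $\mathcal{C}$ is the set of linear functionals $\varphi$ on $l^\infty$ with $\varphi(f)\le \limsup_{n\to\infty}\frac{1}{n}\sum_{i=1}^n f(i)$ for all $f\in l^\infty$. $\mathcal{M}$ is the set of linear functionals $\psi$ on $L^\infty([1,\infty))$ with $\psi(f)\le\limsup_{x\to\infty}\frac{1}{x}\int_1^x f(t)\,dt$ for all $f\in L^\infty([1,\infty))$. $[x]$ denotes the integer part of $x$. *)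

theory Defs
  imports "HOL-Analysis.Analysis"
begin

text \<open>
  Real sequences are indexed by the positive integers, but the index type is \<^typ>\<open>nat\<close>: the
  irrelevant entry at 0 is pinned to 0, so that the elements of this type correspond exactly
  to the bounded functions on the positive integers.
\<close>
typedef linf_seq = "{f :: nat \<Rightarrow> real. f 0 = 0 \<and> bounded (f ` {1..})}"
  morphisms seq_nth Abs_linf_seq
  by (rule exI[of _ "\<lambda>_. 0"]) (auto simp: bounded_iff)

setup_lifting type_definition_linf_seq

instantiation linf_seq :: real_vector
begin

lift_definition zero_linf_seq :: linf_seq is "\<lambda>_. 0"
  by (auto simp: bounded_iff)

lift_definition plus_linf_seq :: "linf_seq \<Rightarrow> linf_seq \<Rightarrow> linf_seq" is "\<lambda>f g n. f n + g n"
  by (auto intro!: bounded_plus_comp)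

lift_definition uminus_linf_seq :: "linf_seq \<Rightarrow> linf_seq" is "\<lambda>f n. - f n"
  by (auto simp: bounded_iff)

lift_definition minus_linf_seq :: "linf_seq \<Rightarrow> linf_seq \<Rightarrow> linf_seq" is "\<lambda>f g n. f n - g n"
  by (auto intro!: bounded_minus_comp)

lift_definition scaleR_linf_seq :: "real \<Rightarrow> linf_seq \<Rightarrow> linf_seq" is "\<lambda>c f n. c * f n"
  by (auto dest: bounded_scaling simp: image_image)

instance
  by standard (transfer; simp add: fun_eq_iff algebra_simps)+

end

definition ess_bounded_measurable :: "(real \<Rightarrow> real) \<Rightarrow> bool" where
  "ess_bounded_measurable f \<longleftrightarrow>
     f \<in> borel_measurable (lebesgue_on {1..}) \<and>
     (\<exists>B. AE x in lebesgue_on {1..}. \<bar>f x\<bar> \<le> B)"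

text \<open>
  Functions on the half-line are represented by total functions on \<^typ>\<open>real\<close>; the quotient
  forgets the values below 1 and identifies functions that agree almost everywhere on the
  half-line.
\<close>
quotient_type linf_fun = "real \<Rightarrow> real" / partial:
  "\<lambda>f g. ess_bounded_measurable f \<and> ess_bounded_measurable g \<and>
         (AE x in lebesgue_on {1..}. f x = g x)"
proof (rule part_equivpI)
  show "\<exists>f. ess_bounded_measurable f \<and> ess_bounded_measurable f \<and>
            (AE x in lebesgue_on {1..}. f x = f x)"
    by (rule exI[of _ "\<lambda>_. 0"]) (auto simp: ess_bounded_measurable_def intro: exI[of _ 0])
qed (auto simp: symp_def transp_def)

lemma ess_bounded_measurable_const: "ess_bounded_measurable (\<lambda>_. c)"
  by (auto simp: ess_bounded_measurable_def)

lemma ess_bounded_measurable_add: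
  assumes "ess_bounded_measurable f" "ess_bounded_measurable g"
  shows "ess_bounded_measurable (\<lambda>x. f x + g x)"
proof -
  from assms obtain A B where
    A: "AE x in lebesgue_on {1..}. \<bar>f x\<bar> \<le> A" and B: "AE x in lebesgue_on {1..}. \<bar>g x\<bar> \<le> B"
    by (auto simp: ess_bounded_measurable_def)
  have "AE x in lebesgue_on {1..}. \<bar>f x + g x\<bar> \<le> A + B"
    using A B by eventually_elim linarith
  with assms show ?thesis
    unfolding ess_bounded_measurable_def
    by (intro conjI borel_measurable_add exI[of _ "A + B"]) auto
qed

lemma ess_bounded_measurable_cmult:
  assumes "ess_bounded_measurable f"
  shows "ess_bounded_measurable (\<lambda>x. c * f x)"
proof -
  from assms obtain A where A: "AE x in lebesgue_on {1..}. \<bar>f x\<bar> \<le> A"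
    by (auto simp: ess_bounded_measurable_def)
  have "AE x in lebesgue_on {1..}. \<bar>c * f x\<bar> \<le> \<bar>c\<bar> * A"
    using A by eventually_elim (simp add: abs_mult mult_left_mono)
  with assms show ?thesis
    unfolding ess_bounded_measurable_def
    by (intro conjI borel_measurable_times borel_measurable_const exI[of _ "\<bar>c\<bar> * A"]) auto
qed

lemma ess_bounded_measurable_uminus:
  "ess_bounded_measurable f \<Longrightarrow> ess_bounded_measurable (\<lambda>x. - f x)"
  using ess_bounded_measurable_cmult[of f "-1"] by simp

lemma ess_bounded_measurable_diff:
  "ess_bounded_measurable f \<Longrightarrow> ess_bounded_measurable g \<Longrightarrow>
   ess_bounded_measurable (\<lambda>x. f x - g x)"
  using ess_bounded_measurable_add[OF _ ess_bounded_measurable_uminus, of f g] by simp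

instantiation linf_fun :: real_vector
begin

lift_definition zero_linf_fun :: linf_fun is "\<lambda>_. 0"
  by (simp add: ess_bounded_measurable_const)

lift_definition plus_linf_fun :: "linf_fun \<Rightarrow> linf_fun \<Rightarrow> linf_fun" is "\<lambda>f g x. f x + g x"
  by (elim conjE, intro conjI ess_bounded_measurable_add, assumption+, erule eventually_elim2, assumption, simp)

lift_definition uminus_linf_fun :: "linf_fun \<Rightarrow> linf_fun" is "\<lambda>f x. - f x"
  by (elim conjE, intro conjI ess_bounded_measurable_uminus, assumption+, erule eventually_mono, simp)

lift_definition minus_linf_fun :: "linf_fun \<Rightarrow> linf_fun \<Rightarrow> linf_fun" is "\<lambda>f g x. f x - g x"
  by (elim conjE, intro conjI ess_bounded_measurable_diff, assumption+, erule eventually_elim2, assumption, simp)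

lift_definition scaleR_linf_fun :: "real \<Rightarrow> linf_fun \<Rightarrow> linf_fun" is "\<lambda>c f x. c * f x"
  by (elim conjE, intro conjI ess_bounded_measurable_cmult, assumption+, erule eventually_mono, simp)

instance
  by standard
    (transfer; (elim conjE)?, intro conjI ess_bounded_measurable_const ess_bounded_measurable_add
       ess_bounded_measurable_diff ess_bounded_measurable_uminus ess_bounded_measurable_cmult AE_I2;
     (assumption | simp add: algebra_simps))+

end

definition cesaro_mean :: "linf_seq \<Rightarrow> nat \<Rightarrow> real" where
  "cesaro_mean f n = (1 / real n) * (\<Sum>i = 1..n. seq_nth f i)"

lift_definition integral_mean :: "linf_fun \<Rightarrow> real \<Rightarrow> real" is
  "\<lambda>f x. (1 / x) * (LINT t:{1..x}|lebesgue. f t)"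
proof -
  fix f g :: "real \<Rightarrow> real"
  assume fg: "ess_bounded_measurable f \<and> ess_bounded_measurable g \<and>
              (AE x in lebesgue_on {1..}. f x = g x)"
  have "(LINT t:{1..x}|lebesgue. f t) = (LINT t:{1..x}|lebesgue. g t)" for x :: real
  proof -
    have meas: "(\<lambda>t. indicator {1..x} t *\<^sub>R h t) \<in> borel_measurable lebesgue"
      if "ess_bounded_measurable h" for h
    proof -
      have "h \<in> borel_measurable (lebesgue_on {1..x})"
        using that unfolding ess_bounded_measurable_def
        by (elim conjE, intro measurable_restrict_mono[of h lebesgue "{1..}" borel "{1..x}"]) auto
      then show ?thesis
        by (subst (asm) borel_measurable_restrict_space_iff) simp_all
    qed
    have "AE t in lebesgue_on {1..}. f t = g t"
      using fg by (elim conjE)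
    then have ae: "AE t in lebesgue. t \<in> {1..} \<longrightarrow> f t = g t"
      by (subst (asm) AE_restrict_space_iff) simp_all
    show ?thesis
      unfolding set_lebesgue_integral_def
    proof (rule integral_cong_AE)
      show "AE t in lebesgue. indicator {1..x} t *\<^sub>R f t = indicator {1..x} t *\<^sub>R g t"
        using ae by eventually_elim (simp add: indicator_def)
    qed (use fg meas in blast)+
  qed
  then show "(\<lambda>x. (1 / x) * (LINT t:{1..x}|lebesgue. f t)) =
             (\<lambda>x. (1 / x) * (LINT t:{1..x}|lebesgue. g t))"
    by simp
qed

definition \<C> :: "(linf_seq \<Rightarrow> real) set" where
  "\<C> = {\<phi>. linear \<phi> \<and> (\<forall>f. ereal (\<phi> f) \<le> limsup (\<lambda>n. ereal (cesaro_mean f n)))}"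

definition \<M> :: "(linf_fun \<Rightarrow> real) set" where
  "\<M> = {\<psi>. linear \<psi> \<and> (\<forall>f. ereal (\<psi> f) \<le> Limsup at_top (\<lambda>x. ereal (integral_mean f x)))}"

text \<open>
  The weak* topology on a set of functionals is the topology of pointwise convergence, i.e.
  the topology induced by the product topology.
\<close>
definition weak_star :: "('v \<Rightarrow> real) set \<Rightarrow> ('v \<Rightarrow> real) topology" where
  "weak_star S = subtopology (product_topology (\<lambda>_. euclideanreal) UNIV) S"

text \<open>
  Affine maps between convex sets of functionals (convexity of the domain is part of the
  definition). Convex combinations are written pointwise since the function type is not an
  instance of \<^class>\<open>real_vector\<close>.
\<close>
definition affine_map_on ::
  "('v \<Rightarrow> real) set \<Rightarrow> ('w \<Rightarrow> real) set \<Rightarrow> (('v \<Rightarrow> real) \<Rightarrow> ('w \<Rightarrow> real)) \<Rightarrow> bool" where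
  "affine_map_on S T F \<longleftrightarrow> F \<in> S \<rightarrow> T \<and>
     (\<forall>p\<in>S. \<forall>q\<in>S. \<forall>t\<in>{0..1::real}.
        (\<lambda>f. (1 - t) * p f + t * q f) \<in> S \<and>
        F (\<lambda>f. (1 - t) * p f + t * q f) = (\<lambda>g. (1 - t) * F p g + t * F q g))"

lift_definition step_fun :: "linf_seq \<Rightarrow> linf_fun" is "\<lambda>f x. f (nat \<lfloor>x\<rfloor>)"
proof -
  fix f :: "nat \<Rightarrow> real"
  assume f: "f 0 = 0 \<and> bounded (f ` {1..})"
  then obtain B where B: "\<And>n. n \<ge> 1 \<Longrightarrow> \<bar>f n\<bar> \<le> B"
    by (auto simp: bounded_iff)
  have "(\<lambda>x::real. f (nat \<lfloor>x\<rfloor>)) \<in> borel_measurable borel"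
    by measurable
  then have "(\<lambda>x::real. f (nat \<lfloor>x\<rfloor>)) \<in> borel_measurable (lebesgue_on {1..})"
    by (intro measurable_restrict_space1) (simp add: measurable_completion)
  moreover have "\<bar>f (nat \<lfloor>x\<rfloor>)\<bar> \<le> B" if "x \<ge> 1" for x :: real
    using that by (intro B) (simp add: le_nat_floor)
  then have "AE x in lebesgue_on {1::real..}. \<bar>f (nat \<lfloor>x\<rfloor>)\<bar> \<le> B"
    by (intro AE_I2) auto
  ultimately show "ess_bounded_measurable (\<lambda>x. f (nat \<lfloor>x\<rfloor>)) \<and>
      ess_bounded_measurable (\<lambda>x. f (nat \<lfloor>x\<rfloor>)) \<and>
      (AE x in lebesgue_on {1::real..}. f (nat \<lfloor>x\<rfloor>) = f (nat \<lfloor>x\<rfloor>))"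
    by (auto simp: ess_bounded_measurable_def)
qed

definition V :: "(linf_fun \<Rightarrow> real) \<Rightarrow> (linf_seq \<Rightarrow> real)" where
  "V \<psi> = (\<lambda>f. \<psi> (step_fun f))"

end

theory Submission
  imports Defs
begin

text \<open>
  The inverse of \<^term>\<open>V\<close> is precomposition with the unit averages
  \<open>(T f)(n) = \<integral>\<^bsub>[n,n+1]\<^esub> f\<close>. Since \<open>\<Sum>\<^bsub>i\<le>n\<^esub> (T f)(i) = \<integral>\<^bsub>[1,n+1]\<^esub> f\<close>, the Cesaro means of \<open>T f\<close>
  and the integral means of \<open>f\<close> are asymptotically equal, so \<open>T\<close> preserves the sublinear functionals
  that define the two sets. It is a left inverse of the step function embedding, and
  \<open>f - step_fun (T f)\<close> has vanishing averages, hence is annihilated by every element of \<^term>\<open>\<M>\<close>.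
\<close>

section \<open>Limits superior\<close>

text \<open>For every \<open>e > 0\<close> one function is eventually below the other plus
  \<open>e\<close>. The constant \<open>e\<close> leaves the \<open>Limsup\<close> because the
  filter is proper, and the argument is symmetric.\<close>

lemma Limsup_ereal_cong_diff_tendsto_0:
  fixes a b :: "'a \<Rightarrow> real"
  assumes F: "F \<noteq> bot" and lim: "((\<lambda>x. a x - b x) \<longlongrightarrow> 0) F"
  shows "Limsup F (\<lambda>x. ereal (a x)) = Limsup F (\<lambda>x. ereal (b x))"
proof -
  have le: "Limsup F (\<lambda>x. ereal (u x)) \<le> Limsup F (\<lambda>x. ereal (v x))"
    if "((\<lambda>x. u x - v x) \<longlongrightarrow> 0) F" for u v :: "'a \<Rightarrow> real"
  proof (rule ereal_le_epsilon2)
    fix e :: real assume "0 < e"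
    with that have "eventually (\<lambda>x. u x - v x < e) F"
      by (rule order_tendstoD)
    then have "Limsup F (\<lambda>x. ereal (u x)) \<le> Limsup F (\<lambda>x. ereal (v x) + ereal e)"
      by (intro Limsup_mono) (auto elim: eventually_mono)
    also have "\<dots> = Limsup F (\<lambda>x. ereal (v x)) + ereal e"
      using F by (rule Limsup_add_ereal_right) simp
    finally show "Limsup F (\<lambda>x. ereal (u x)) \<le> Limsup F (\<lambda>x. ereal (v x)) + ereal e" .
  qed
  have "((\<lambda>x. b x - a x) \<longlongrightarrow> 0) F"
    using tendsto_minus[OF lim] by simp
  with lim show ?thesis
    by (intro antisym le)
qed

lemma filterlim_nat_floor_at_top: "filterlim (\<lambda>x::real. nat \<lfloor>x\<rfloor>) sequentially at_top"
  by (rule filterlim_compose[OF filterlim_nat_sequentially filterlim_floor_sequentially])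

text \<open>Eventual strict upper bounds pull back along the floor in one direction and along
  \<open>real\<close> in the other, since the floor of \<open>real n\<close> is
  \<open>n\<close>.\<close>

lemma Limsup_nat_floor:
  fixes u :: "nat \<Rightarrow> 'a :: complete_linorder"
  shows "Limsup at_top (\<lambda>x::real. u (nat \<lfloor>x\<rfloor>)) = limsup u"
proof (rule antisym)
  show "Limsup at_top (\<lambda>x::real. u (nat \<lfloor>x\<rfloor>)) \<le> limsup u"
    unfolding Limsup_le_iff
  proof (intro allI impI)
    fix y assume "limsup u < y"
    then have "eventually (\<lambda>n. u n < y) sequentially"
      \<comment> \<open>Applied to the reflexive inequality, the characterization turns each strict
        upper bound of the limsup into an eventual bound.\<close>
      using Limsup_le_iff[of sequentially u "limsup u"] by blast
    then show "eventually (\<lambda>x::real. u (nat \<lfloor>x\<rfloor>) < y) at_top"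
      using filterlim_nat_floor_at_top by (rule eventually_compose_filterlim)
  qed
  show "limsup u \<le> Limsup at_top (\<lambda>x::real. u (nat \<lfloor>x\<rfloor>))" (is "_ \<le> ?L")
    unfolding Limsup_le_iff
  proof (intro allI impI)
    fix y assume "?L < y"
    then have "eventually (\<lambda>x::real. u (nat \<lfloor>x\<rfloor>) < y) at_top"
      using Limsup_le_iff[of at_top "\<lambda>x::real. u (nat \<lfloor>x\<rfloor>)" ?L] by blast
    then have "eventually (\<lambda>n. u (nat \<lfloor>real n\<rfloor>) < y) sequentially"
      using filterlim_real_sequentially by (rule eventually_compose_filterlim)
    then show "eventually (\<lambda>n. u n < y) sequentially"
      by simp
  qed
qed

section \<open>Integrals of essentially bounded functions\<close>

text \<open>The bound is made nonnegative for later estimates, and is stated over all of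
  \<open>lebesgue\<close> so that it restricts to any interval in the half-line.\<close>

lemma ess_bounded_measurableE:
  assumes "ess_bounded_measurable f"
  obtains B where "0 \<le> B" "AE x in lebesgue. 1 \<le> x \<longrightarrow> \<bar>f x\<bar> \<le> B"
proof -
  from assms obtain B where "AE x in lebesgue_on {1..}. \<bar>f x\<bar> \<le> B"
    by (auto simp: ess_bounded_measurable_def)
  then have "AE x in lebesgue. x \<in> {1..} \<longrightarrow> \<bar>f x\<bar> \<le> B"
    by (subst (asm) AE_restrict_space_iff) simp_all
  then have "AE x in lebesgue. 1 \<le> x \<longrightarrow> \<bar>f x\<bar> \<le> max B 0"
    by eventually_elim auto
  then show thesis
    by (intro that[of "max B 0"]) auto
qed

lemma set_borel_measurable_Icc_ess_bounded:
  assumes "ess_bounded_measurable f" "1 \<le> a"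
  shows "set_borel_measurable lebesgue {a..b} f"
proof -
  have "f \<in> borel_measurable (lebesgue_on {a..b})"
    using assms unfolding ess_bounded_measurable_def
    by (elim conjE, intro measurable_restrict_mono[of f lebesgue "{1..}" borel "{a..b}"]) auto
  then show ?thesis
    unfolding set_borel_measurable_def
    by (subst (asm) borel_measurable_restrict_space_iff) simp_all
qed

lemma set_integrable_Icc_const: "set_integrable lebesgue {a..b::real} (\<lambda>_. c::real)"
  unfolding set_integrable_def by (cases "a \<le> b") (auto intro!: integrable_scaleR_left)

lemma set_integrable_Icc_ess_bounded:
  assumes "ess_bounded_measurable f" "1 \<le> a"
  shows "set_integrable lebesgue {a..b} f"
proof -
  obtain B where B: "AE x in lebesgue. 1 \<le> x \<longrightarrow> \<bar>f x\<bar> \<le> B"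
    using assms(1) by (rule ess_bounded_measurableE)
  show ?thesis
  proof (rule set_integrable_bound[OF set_integrable_Icc_const[of a b B]])
    show "set_borel_measurable lebesgue {a..b} f"
      using assms by (rule set_borel_measurable_Icc_ess_bounded)
    show "AE x in lebesgue. x \<in> {a..b} \<longrightarrow> norm (f x) \<le> norm B"
      using B by eventually_elim (use assms(2) in auto)
  qed
qed

lemma set_integral_Icc_abs_le:
  assumes "ess_bounded_measurable f" "AE x in lebesgue. 1 \<le> x \<longrightarrow> \<bar>f x\<bar> \<le> B" "1 \<le> a" "a \<le> b"
  shows "\<bar>LINT x:{a..b}|lebesgue. f x\<bar> \<le> B * (b - a)"
proof -
  note int = set_integrable_Icc_ess_bounded[OF assms(1,3), of b]
  have "\<bar>LINT x:{a..b}|lebesgue. f x\<bar> \<le> (LINT x:{a..b}|lebesgue. \<bar>f x\<bar>)"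
    using set_integral_norm_bound[OF int] by simp
  also have "\<dots> \<le> (LINT x:{a..b}|lebesgue. B)"
    using assms(2,3)
    by (intro set_integral_mono_AE set_integrable_abs int set_integrable_Icc_const)
      (auto elim: eventually_mono)
  also have "\<dots> = B * (b - a)"
    using assms(4) by (simp add: set_lebesgue_integral_def)
  finally show ?thesis .
qed

text \<open>Makes integrals over such intervals well defined on the classes of
  \<open>linf_fun\<close>.\<close>

lemma set_integral_Icc_cong_AE:
  assumes "ess_bounded_measurable f" "ess_bounded_measurable g"
    and "AE x in lebesgue_on {1..}. f x = g x" "1 \<le> a"
  shows "(LINT x:{a..b}|lebesgue. f x) = (LINT x:{a..b}|lebesgue. g x)"
proof -
  have ae: "AE x in lebesgue. x \<in> {1..} \<longrightarrow> f x = g x"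
    using assms(3) by (subst (asm) AE_restrict_space_iff) simp_all
  show ?thesis
    unfolding set_lebesgue_integral_def
  proof (rule integral_cong_AE)
    show "AE x in lebesgue. indicator {a..b} x *\<^sub>R f x = indicator {a..b} x *\<^sub>R g x"
      using ae by eventually_elim (use assms(4) in \<open>simp add: indicator_def\<close>)
  qed (use assms set_borel_measurable_Icc_ess_bounded in \<open>auto simp: set_borel_measurable_def\<close>)
qed

lemma set_integral_Icc_combine:
  assumes "ess_bounded_measurable f" "1 \<le> a" "a \<le> b" "b \<le> c"
  shows "(LINT x:{a..c}|lebesgue. f x) =
    (LINT x:{a..b}|lebesgue. f x) + (LINT x:{b..c}|lebesgue. f x)"
proof -
  \<comment> \<open>The two closed intervals share only \<open>b\<close>, a null set.\<close>
  have "AE x in lebesgue. x \<noteq> b"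
    by (rule AE_completion[OF AE_lborel_singleton])
  then have "AE x in lebesgue. \<not> (x \<in> {a..b} \<and> x \<in> {b..c})"
    by eventually_elim auto
  then have "(LINT x:{a..b} \<union> {b..c}|lebesgue. f x) =
      (LINT x:{a..b}|lebesgue. f x) + (LINT x:{b..c}|lebesgue. f x)"
    using assms by (intro set_integral_Un_AE set_integrable_Icc_ess_bounded) auto
  then show ?thesis
    using assms by (simp add: ivl_disj_un_two_touch)
qed

section \<open>Unit averages\<close>

text \<open>This is the operator \<open>T\<close>. The case \<open>n = 0\<close> meets the
  convention of \<open>linf_seq\<close>, and it keeps the intervals of integration inside the
  half-line.\<close>

lift_definition unit_averages :: "linf_fun \<Rightarrow> linf_seq" is
  "\<lambda>f n. if n = 0 then 0 else (LINT t:{real n..real n + 1}|lebesgue. f t)"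
proof -
  fix f g :: "real \<Rightarrow> real"
  assume fg: "ess_bounded_measurable f \<and> ess_bounded_measurable g \<and>
              (AE x in lebesgue_on {1..}. f x = g x)"
  obtain B where "AE x in lebesgue. 1 \<le> x \<longrightarrow> \<bar>f x\<bar> \<le> B"
    using fg ess_bounded_measurableE by blast
  \<comment> \<open>The intervals have length 1, so the essential bound of \<open>f\<close> also
    bounds the averages.\<close>
  then have "\<bar>LINT t:{real n..real n + 1}|lebesgue. f t\<bar> \<le> B" if "1 \<le> n" for n
    using set_integral_Icc_abs_le[of f B "real n" "real n + 1"] fg that by simp
  then show "((if 0 = (0::nat) then 0 else LINT t:{real 0..real 0 + 1}|lebesgue. f t) = 0 \<and>
      bounded ((\<lambda>n. if n = 0 then 0 else LINT t:{real n..real n + 1}|lebesgue. f t) ` {1..})) \<and>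
      (\<lambda>n. if n = 0 then 0 else LINT t:{real n..real n + 1}|lebesgue. f t) =
      (\<lambda>n. if n = 0 then 0 else LINT t:{real n..real n + 1}|lebesgue. g t)"
    using fg by (auto simp: bounded_iff fun_eq_iff intro!: exI[of _ B] set_integral_Icc_cong_AE)
qed

lemma linear_unit_averages: "linear unit_averages"
proof (rule linearI)
  show "unit_averages (f + g) = unit_averages f + unit_averages g" for f g
    by transfer (auto simp: fun_eq_iff intro!: set_integral_add(2) set_integrable_Icc_ess_bounded)
  show "unit_averages (c *\<^sub>R f) = c *\<^sub>R unit_averages f" for c f
    by transfer (auto simp: fun_eq_iff)
qed

text \<open>Read off from the respectfulness theorem of the lifted \<open>step_fun\<close>, whose
  proof contains the measurability and the bound.\<close>

lemma ess_bounded_measurable_nat_floor: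
  assumes "f 0 = 0" "bounded (f ` {1..})"
  shows "ess_bounded_measurable (\<lambda>x. f (nat \<lfloor>x\<rfloor>))"
  using step_fun.rsp assms by (auto simp: rel_fun_def eq_onp_def)

lemma linear_step_fun: "linear step_fun"
proof (rule linearI)
  show "step_fun (f + g) = step_fun f + step_fun g" for f g
    by transfer (auto intro!: ess_bounded_measurable_nat_floor bounded_plus_comp)
  show "step_fun (c *\<^sub>R f) = c *\<^sub>R step_fun f" for c f
    by transfer (auto intro!: ess_bounded_measurable_cmult ess_bounded_measurable_nat_floor)
qed

lemma unit_averages_step_fun: "unit_averages (step_fun f) = f"
proof transfer
  fix f :: "nat \<Rightarrow> real"
  assume f: "f 0 = 0 \<and> bounded (f ` {1..})"
  have "(LINT t:{real n..real n + 1}|lebesgue. f (nat \<lfloor>t\<rfloor>)) = f n" if "n \<noteq> 0" for n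
  proof -
    \<comment> \<open>At the right endpoint of the closed interval the floor already jumps to
      \<open>n + 1\<close>; this single point is discarded.\<close>
    have "AE t in lebesgue. t \<noteq> real n + 1"
      by (rule AE_completion[OF AE_lborel_singleton])
    then have ae: "AE t in lebesgue. t \<in> {real n..real n + 1} \<longrightarrow> f (nat \<lfloor>t\<rfloor>) = f n"
    proof eventually_elim
      fix t assume "t \<noteq> real n + 1"
      then have "\<lfloor>t\<rfloor> = int n" if "t \<in> {real n..real n + 1}"
        using that by (intro floor_unique) auto
      then show "t \<in> {real n..real n + 1} \<longrightarrow> f (nat \<lfloor>t\<rfloor>) = f n"
        by simp
    qed
    have "set_borel_measurable lebesgue {real n..real n + 1} (\<lambda>t. f (nat \<lfloor>t\<rfloor>))"
      using f that
      by (intro set_borel_measurable_Icc_ess_bounded ess_bounded_measurable_nat_floor) auto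
    then have "(LINT t:{real n..real n + 1}|lebesgue. f (nat \<lfloor>t\<rfloor>)) =
        (LINT t:{real n..real n + 1}|lebesgue. f n)"
      unfolding set_lebesgue_integral_def set_borel_measurable_def
    proof (rule integral_cong_AE)
      show "AE t in lebesgue. indicator {real n..real n + 1} t *\<^sub>R f (nat \<lfloor>t\<rfloor>) =
          indicator {real n..real n + 1} t *\<^sub>R f n"
        using ae by eventually_elim (simp add: indicator_def)
      show "(\<lambda>t. indicator {real n..real n + 1} t *\<^sub>R f n) \<in> borel_measurable lebesgue"
        using set_integrable_Icc_const unfolding set_integrable_def
        by (rule borel_measurable_integrable)
    qed
    also have "\<dots> = f n"
      by (simp add: set_lebesgue_integral_def)
    finally show ?thesis .
  qed
  with f show "(\<lambda>n. if n = 0 then 0 else LINT t:{real n..real n + 1}|lebesgue. f (nat \<lfloor>t\<rfloor>)) = f"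
    by auto
qed

section \<open>Comparison of integral means with Cesaro means\<close>

lemma sum_set_integral_unit_Icc:
  assumes "ess_bounded_measurable f"
  shows "(\<Sum>i = 1..n. LINT t:{real i..real i + 1}|lebesgue. f t) =
    (LINT t:{1..real n + 1}|lebesgue. f t)"
proof (induction n)
  case 0
  \<comment> \<open>The general bound carries the length of the interval as a factor, here
    0.\<close>
  have "\<bar>LINT t:{1..1}|lebesgue. f t\<bar> \<le> 0"
    using ess_bounded_measurableE[OF assms] set_integral_Icc_abs_le[OF assms, of _ 1 1] by auto
  then show ?case
    by simp
next
  case (Suc n)
  then show ?case
    using set_integral_Icc_combine[OF assms, of 1 "real n + 1" "real n + 1 + 1"]
    by (simp add: add.commute)
qed

text \<open>The error has two parts, each at most \<open>B / x\<close>. Changing the prefactor from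
  \<open>1 / n\<close> to \<open>1 / x\<close> acts on an integral of size at most
  \<open>B * n\<close> and costs \<open>B * (x - n) / x\<close>; the integral from \<open>x\<close>
  to \<open>n + 1\<close> has size at most \<open>B\<close>.\<close>

lemma abs_integral_mean_diff_le:
  fixes x :: real
  assumes f: "ess_bounded_measurable f" and B: "AE x in lebesgue. 1 \<le> x \<longrightarrow> \<bar>f x\<bar> \<le> B" "0 \<le> B"
    and "0 < n" "real n \<le> x" "x \<le> real n + 1"
  shows "\<bar>1 / x * (LINT t:{1..x}|lebesgue. f t) -
    1 / real n * (LINT t:{1..real n + 1}|lebesgue. f t)\<bar> \<le> 2 * B / x"
proof -
  have n: "1 \<le> real n" "1 \<le> x" and "0 < x"
    using assms(4,5) by auto
  let ?I = "\<lambda>a b. LINT t:{a..b}|lebesgue. f t"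
  have "?I 1 (real n + 1) = ?I 1 x + ?I x (real n + 1)"
    using assms n by (intro set_integral_Icc_combine) auto
  then have "1 / x * ?I 1 x - 1 / real n * ?I 1 (real n + 1) =
      - (?I 1 (real n + 1) * (1 / real n - 1 / x) + ?I x (real n + 1) / x)"
    by (simp add: algebra_simps add_divide_distrib)
  also have "\<bar>\<dots>\<bar> \<le> \<bar>?I 1 (real n + 1)\<bar> * (1 / real n - 1 / x) + \<bar>?I x (real n + 1)\<bar> / x"
  proof -
    have "0 \<le> 1 / real n - 1 / x"
      using assms n by (simp add: frac_le)
    then show ?thesis
      using \<open>0 < x\<close> abs_triangle_ineq[of "?I 1 (real n + 1) * (1 / real n - 1 / x)"
        "?I x (real n + 1) / x"]
      unfolding abs_minus_cancel by (simp add: abs_mult)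
  qed
  also have "\<dots> \<le> (B * real n) * (1 / real n - 1 / x) + B / x"
  proof (intro add_mono mult_right_mono divide_right_mono)
    show "\<bar>?I 1 (real n + 1)\<bar> \<le> B * real n"
      using set_integral_Icc_abs_le[OF f B(1), of 1 "real n + 1"] by simp
    have "\<bar>?I x (real n + 1)\<bar> \<le> B * (real n + 1 - x)"
      using assms n by (intro set_integral_Icc_abs_le) auto
    also have "\<dots> \<le> B * 1"
      using assms by (intro mult_left_mono) auto
    finally show "\<bar>?I x (real n + 1)\<bar> \<le> B"
      by simp
  qed (use assms n in \<open>simp_all add: frac_le\<close>)
  also have "(B * real n) * (1 / real n - 1 / x) = B * (x - real n) / x"
    using n by (simp add: field_simps)
  also have "\<dots> + B / x \<le> 2 * B / x"
  proof -
    have "B * (x - real n) \<le> B * 1"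
      using assms by (intro mult_left_mono) auto
    then show ?thesis
      using \<open>0 < x\<close> by (simp add: divide_right_mono flip: add_divide_distrib)
  qed
  finally show ?thesis .
qed

lemma integral_mean_minus_cesaro_mean_tendsto:
  "((\<lambda>x. integral_mean f x - cesaro_mean (unit_averages f) (nat \<lfloor>x\<rfloor>)) \<longlongrightarrow> 0) at_top"
  \<comment> \<open>Exposes \<open>seq_nth\<close>, so that \<open>transfer\<close> reaches the
    integrals behind \<open>unit_averages\<close>.\<close>
  unfolding cesaro_mean_def
proof transfer
  fix f :: "real \<Rightarrow> real"
  assume "ess_bounded_measurable f \<and> ess_bounded_measurable f \<and>
    (AE x in lebesgue_on {1..}. f x = f x)"
  then have f: "ess_bounded_measurable f"
    by simp
  then obtain B where B: "0 \<le> B" "AE x in lebesgue. 1 \<le> x \<longrightarrow> \<bar>f x\<bar> \<le> B"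
    by (rule ess_bounded_measurableE)
  let ?T = "\<lambda>i. if i = 0 then 0 else LINT t:{real i..real i + 1}|lebesgue. f t"
  have sum: "(\<Sum>i = 1..n. ?T i) = (LINT t:{1..real n + 1}|lebesgue. f t)" for n
    by (subst sum_set_integral_unit_Icc[OF f, symmetric]) (rule sum.cong, auto)
  \<comment> \<open>From \<open>1 \<le> x\<close> on, the floor is positive and serves as the
    \<open>n\<close> of the preceding estimate.\<close>
  have "norm (1 / x * (LINT t:{1..x}|lebesgue. f t) -
      1 / real (nat \<lfloor>x\<rfloor>) * (\<Sum>i = 1..nat \<lfloor>x\<rfloor>. ?T i)) \<le> 2 * B / x" if "1 \<le> x" for x :: real
  proof -
    have "real (nat \<lfloor>x\<rfloor>) = of_int \<lfloor>x\<rfloor>" "0 < nat \<lfloor>x\<rfloor>"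
      using that by simp_all
    then show ?thesis
      unfolding sum real_norm_def by (intro abs_integral_mean_diff_le f B) linarith+
  qed
  with eventually_ge_at_top[of "1::real"]
  have "eventually (\<lambda>x. norm (1 / x * (LINT t:{1..x}|lebesgue. f t) -
      1 / real (nat \<lfloor>x\<rfloor>) * (\<Sum>i = 1..nat \<lfloor>x\<rfloor>. ?T i)) \<le> 2 * B / x) at_top"
    by (rule eventually_mono)
  moreover have "((\<lambda>x::real. 2 * B / x) \<longlongrightarrow> 0) at_top"
    by (intro tendsto_divide_0[OF tendsto_const] filterlim_at_top_imp_at_infinity filterlim_ident)
  ultimately show "((\<lambda>x. 1 / x * (LINT t:{1..x}|lebesgue. f t) -
      1 / real (nat \<lfloor>x\<rfloor>) * (\<Sum>i = 1..nat \<lfloor>x\<rfloor>. ?T i)) \<longlongrightarrow> 0) at_top"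
    by (rule Lim_null_comparison)
qed

text \<open>The sublinear functional defining \<open>\<M>\<close> is thus the one defining
  \<open>\<C>\<close> composed with \<open>unit_averages\<close>; all later membership proofs rest
  on this.\<close>

lemma Limsup_integral_mean:
  "Limsup at_top (\<lambda>x. ereal (integral_mean f x)) =
   limsup (\<lambda>n. ereal (cesaro_mean (unit_averages f) n))"
proof -
  have "Limsup at_top (\<lambda>x. ereal (integral_mean f x)) =
      Limsup at_top (\<lambda>x::real. ereal (cesaro_mean (unit_averages f) (nat \<lfloor>x\<rfloor>)))"
    by (rule Limsup_ereal_cong_diff_tendsto_0[OF _ integral_mean_minus_cesaro_mean_tendsto]) simp
  also have "\<dots> = limsup (\<lambda>n. ereal (cesaro_mean (unit_averages f) n))"
    by (rule Limsup_nat_floor)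
  finally show ?thesis .
qed

section \<open>The homeomorphism\<close>

text \<open>Averaging \<open>step_fun f\<close> returns \<open>f\<close>, so the bound on \<psi> at
  \<open>step_fun f\<close> is exactly the Cesaro bound at \<open>f\<close>.\<close>

lemma V_in_\<C>:
  assumes "\<psi> \<in> \<M>"
  shows "V \<psi> \<in> \<C>"
proof -
  have "linear (\<psi> \<circ> step_fun)"
    using assms by (intro linear_compose linear_step_fun) (simp add: \<M>_def)
  moreover have "ereal (\<psi> (step_fun f)) \<le> limsup (\<lambda>n. ereal (cesaro_mean f n))" for f
  proof -
    have "ereal (\<psi> (step_fun f)) \<le> Limsup at_top (\<lambda>x. ereal (integral_mean (step_fun f) x))"
      using assms by (simp add: \<M>_def)
    then show ?thesis
      by (simp add: Limsup_integral_mean unit_averages_step_fun)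
  qed
  ultimately show ?thesis
    by (simp add: \<C>_def V_def comp_def)
qed

lemma comp_unit_averages_in_\<M>:
  assumes "\<phi> \<in> \<C>"
  shows "\<phi> \<circ> unit_averages \<in> \<M>"
  using assms linear_compose[OF linear_unit_averages, of \<phi>]
  by (auto simp: \<M>_def \<C>_def Limsup_integral_mean)

lemma V_comp_unit_averages: "V (\<phi> \<circ> unit_averages) = \<phi>"
  by (simp add: V_def unit_averages_step_fun fun_eq_iff)

text \<open>The sublinear bound vanishes at both \<open>g\<close> and \<open>- g\<close>, which
  forces \<psi> to be at most 0 at each of them.\<close>

lemma \<M>_eq_0_if_unit_averages_eq_0:
  assumes "\<psi> \<in> \<M>" "unit_averages g = 0"
  shows "\<psi> g = 0"
proof -
  have lin: "linear \<psi>"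
    using assms(1) by (simp add: \<M>_def)
  have le: "\<psi> h \<le> 0" if "unit_averages h = 0" for h
  proof -
    have "cesaro_mean 0 n = 0" for n
      by (simp add: cesaro_mean_def zero_linf_seq.rep_eq)
    moreover have "ereal (\<psi> h) \<le> Limsup at_top (\<lambda>x. ereal (integral_mean h x))"
      using assms(1) by (simp add: \<M>_def)
    ultimately show ?thesis
      by (simp add: Limsup_integral_mean that Limsup_const zero_ereal_def)
  qed
  have "unit_averages (- g) = 0"
    using assms(2) by (simp add: linear_neg[OF linear_unit_averages])
  then have "\<psi> (- g) \<le> 0"
    by (rule le)
  with le[OF assms(2)] show ?thesis
    by (simp add: linear_neg[OF lin])
qed

text \<open>The left inverse identity for \<open>V\<close>:
  \<open>step_fun (unit_averages f)\<close> and \<open>f\<close> have the same averages, so \<psi>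
  cannot separate them.\<close>

lemma V_unit_averages:
  assumes "\<psi> \<in> \<M>"
  shows "V \<psi> \<circ> unit_averages = \<psi>"
proof
  fix f
  have "unit_averages (step_fun (unit_averages f) - f) = 0"
    by (simp add: linear_diff[OF linear_unit_averages] unit_averages_step_fun)
  then have "\<psi> (step_fun (unit_averages f) - f) = 0"
    using assms \<M>_eq_0_if_unit_averages_eq_0 by blast
  moreover have "linear \<psi>"
    using assms by (simp add: \<M>_def)
  ultimately show "(V \<psi> \<circ> unit_averages) f = \<psi> f"
    by (simp add: V_def linear_diff)
qed

text \<open>A convex combination is at most the larger of the two values, and both lie below the
  same \<open>Limsup\<close>; this avoids arithmetic with extended reals.\<close>

lemma convex_combination_in_\<M>:
  fixes t :: real
  assumes p: "p \<in> \<M>" and q: "q \<in> \<M>" and t: "t \<in> {0..1}"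
  shows "(\<lambda>f. (1 - t) * p f + t * q f) \<in> \<M>"
proof -
  have "linear (\<lambda>f. (1 - t) *\<^sub>R p f + t *\<^sub>R q f)"
    using p q by (intro linear_compose_add linear_compose_scale_right) (auto simp: \<M>_def)
  moreover have "ereal ((1 - t) * p f + t * q f) \<le> Limsup at_top (\<lambda>x. ereal (integral_mean f x))"
    for f
  proof -
    have "(1 - t) * p f + t * q f \<le> max (p f) (q f)"
      using t by (intro convex_bound_le) auto
    then have "ereal ((1 - t) * p f + t * q f) \<le> ereal (max (p f) (q f))"
      by (simp del: ereal_max)
    also have "\<dots> \<le> Limsup at_top (\<lambda>x. ereal (integral_mean f x))"
      using p q by (simp add: \<M>_def)
    finally show ?thesis .
  qed
  ultimately show ?thesis
    by (simp add: \<M>_def)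
qed

lemma topspace_weak_star [simp]: "topspace (weak_star S) = S"
  by (simp add: weak_star_def)

text \<open>Both \<open>V\<close> and its inverse are precompositions. Evaluating the image at
  \<open>v\<close> means evaluating \<phi> at \<open>h v\<close>, which is a coordinate
  projection.\<close>

lemma continuous_map_weak_star_comp:
  assumes "\<And>\<phi>. \<phi> \<in> S \<Longrightarrow> \<phi> \<circ> h \<in> T"
  shows "continuous_map (weak_star S) (weak_star T) (\<lambda>\<phi>. \<phi> \<circ> h)"
proof -
  have "continuous_map (weak_star S) euclideanreal (\<lambda>\<phi>. \<phi> (h v))" for v
    unfolding weak_star_def
    by (intro continuous_map_from_subtopology continuous_map_product_projection) simp
  then show ?thesis
    using assms
    \<comment> \<open>Only the codomain is unfolded, which leaves coordinatewise continuity and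
      membership in \<open>T\<close>.\<close>
    by (subst (2) weak_star_def)
      (auto simp: continuous_map_in_subtopology continuous_map_componentwise_UNIV)
qed

theorem theorem3p2:
  shows "affine_map_on \<M> \<C> V \<and> homeomorphic_map (weak_star \<M>) (weak_star \<C>) V"
proof
  show "affine_map_on \<M> \<C> V"
    unfolding affine_map_on_def
    using V_in_\<C> convex_combination_in_\<M> by (auto simp: V_def)
  have V_eq: "V = (\<lambda>\<psi>. \<psi> \<circ> step_fun)"
    by (simp add: V_def fun_eq_iff)
  have "continuous_map (weak_star \<M>) (weak_star \<C>) V"
    unfolding V_eq using V_in_\<C> by (intro continuous_map_weak_star_comp) (simp add: V_eq)
  moreover have "continuous_map (weak_star \<C>) (weak_star \<M>) (\<lambda>\<phi>. \<phi> \<circ> unit_averages)"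
    by (intro continuous_map_weak_star_comp comp_unit_averages_in_\<M>)
  ultimately have "homeomorphic_maps (weak_star \<M>) (weak_star \<C>) V (\<lambda>\<phi>. \<phi> \<circ> unit_averages)"
    by (simp add: homeomorphic_maps_def V_comp_unit_averages V_unit_averages)
  then show "homeomorphic_map (weak_star \<M>) (weak_star \<C>) V"
    by (rule homeomorphic_maps_imp_map)
qed

end
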